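(* Let $p$ be a prime and let $R$ be a pro-$p$ domain. Let $M$ and $N$ be compact $R$-analytic manifolds and let $F\colon M\to N$ be an $R$-analytic map such that $|\operatorname{im}F|<2^{\aleph_0}$. Then $\operatorname{im}F$ is finite.
   Context: Notation: $X^{(n)}$ is the $n$-th Cartesian power of a set $X$; in particular, for an ideal $I$ of $R$, $I^{(n)}\subseteq R^{(n)}$ is the set of $n$-tuples of elements of $I$, while $I^L$ denotes the usual power of an ideal. Pro-$p$ domain: a Noetherian complete local integral domain $R$ whose residue field is finite of characteristic $p$; its maximal ideal is $\mathfrak{m}$ and $R$ carries the $\mathfrak{m}$-adic topology. Analytic maps: a map $f\colon U\to R^{(m)}$, with $U\subseteq R^{(n)}$ open, is analytic if for each $x\in U$ there are a positive integer $L$ with $x+(\mathfrak{m}^L)^{(n)}\subseteq U$ and a tuple of power series $\mathbf{F}\in R[[X_1,\dots,X_n]]^{(m)}$ with $f(x+y)=\mathbf{F}(y)$ for all $y\in(\mathfrak{m}^L)^{(n)}$. $R$-analytic manifold: a topological space $M$ such that each $x\in M$ has an $R$-chart $(U,\phi,n)$, i.e. $x\in U$, $U$ is open in $M$, and $\phi$ is a homeomorphism from $U$ onto an open subset of $R^{(n)}$ ($n\ge 0$ is the dimension of the chart), all charts being compatible: if $(U,\phi,n)$, $(V,\psi,m)$ are charts with $U\cap V\neq\varnothing$, then $\phi\circ\psi^{-1}\colon\psi(U\cap V)\to R^{(n)}$ is analytic. $R$-analytic map between $R$-analytic manifolds: a map $F\colon M\to N$ such that for each $x\in M$ there are $R$-charts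 $(U,\varphi,m)$ of $x$ in $M$ and $(V,\psi,n)$ of $F(x)$ in $N$ such that $F^{-1}(V)$ is open in $M$ and $\psi\circ F\circ\varphi^{-1}$ restricted to $\varphi(U\cap F^{-1}(V))$ is analytic. *)

theory Defs
  imports
    "HOL-Algebra.QuotRing"
    "HOL-Algebra.Ideal_Product"
    "HOL-Algebra.Ring_Divisibility"
    "HOL-Computational_Algebra.Primes"
    "HOL-Analysis.Function_Topology"
    "HOL-Analysis.Abstract_Limits"
    "HOL-Library.Equipollence"
begin

abbreviation ideal_power :: "('a, 'b) ring_scheme \<Rightarrow> 'a set \<Rightarrow> nat \<Rightarrow> 'a set" where
  "ideal_power R I L \<equiv> I [^]\<^bsub>ideals_set R\<^esub> L"

definition adic_topology :: "('a, 'b) ring_scheme \<Rightarrow> 'a set \<Rightarrow> 'a topology" where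
  "adic_topology R I =
     topology (\<lambda>U. U \<subseteq> carrier R \<and> (\<forall>x\<in>U. \<exists>L. x <+\<^bsub>R\<^esub> ideal_power R I L \<subseteq> U))"

lemma ideal_power_Suc: "ideal_power R I (Suc L) = ideal_power R I L \<cdot>\<^bsub>R\<^esub> I"
  by (simp add: ideals_set_def nat_pow_def)

lemma ideal_power_ideal:
  assumes "ring R" "ideal I R"
  shows "ideal (ideal_power R I L) R"
proof (induction L)
  case 0
  show ?case
    using ring.oneideal[OF assms(1)] by (simp add: ideals_set_def nat_pow_def)
next
  case (Suc L)
  then show ?case
    using ring.ideal_prod_is_ideal[OF assms(1) Suc assms(2)] unfolding ideal_power_Suc by blast
qed

lemma ideal_power_antimono:
  assumes "ring R" "ideal I R" "L \<le> L'"
  shows "ideal_power R I L' \<subseteq> ideal_power R I L"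
  using assms(3)
proof (induction L' rule: dec_induct)
  case (step L')
  then show ?case
    using ring.ideal_prod_inter[OF assms(1) ideal_power_ideal[OF assms(1,2)] assms(2)]
    unfolding ideal_power_Suc by blast
qed simp

lemma openin_adic_topology:
  assumes "ring R" "ideal I R"
  shows "openin (adic_topology R I) U \<longleftrightarrow>
    U \<subseteq> carrier R \<and> (\<forall>x\<in>U. \<exists>L. x <+\<^bsub>R\<^esub> ideal_power R I L \<subseteq> U)"
proof -
  let ?P = "\<lambda>U. U \<subseteq> carrier R \<and> (\<forall>x\<in>U. \<exists>L. x <+\<^bsub>R\<^esub> ideal_power R I L \<subseteq> U)"
  have mono: "x <+\<^bsub>R\<^esub> ideal_power R I L' \<subseteq> x <+\<^bsub>R\<^esub> ideal_power R I L" if "L \<le> L'" for x L L'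
    using ideal_power_antimono[OF assms that] by (auto simp: a_l_coset_defs)
  have "?P (S \<inter> T)" if S: "?P S" and T: "?P T" for S T
  proof (intro conjI ballI)
    fix x assume "x \<in> S \<inter> T"
    then obtain L1 L2 where "x <+\<^bsub>R\<^esub> ideal_power R I L1 \<subseteq> S" "x <+\<^bsub>R\<^esub> ideal_power R I L2 \<subseteq> T"
      using S T by blast
    then have "x <+\<^bsub>R\<^esub> ideal_power R I (max L1 L2) \<subseteq> S \<inter> T"
      using mono[of L1 "max L1 L2" x] mono[of L2 "max L1 L2" x] by auto
    then show "\<exists>L. x <+\<^bsub>R\<^esub> ideal_power R I L \<subseteq> S \<inter> T" ..
  qed (use S in auto)
  moreover have "?P (\<Union>K)" if "\<forall>U\<in>K. ?P U" for K
    using that by (meson Sup_least Union_iff Union_upper subset_trans)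
  ultimately have "istopology ?P"
    unfolding istopology_def by blast
  then show ?thesis
    by (simp add: adic_topology_def topology_inverse')
qed

definition adic_complete :: "('a, 'b) ring_scheme \<Rightarrow> 'a set \<Rightarrow> bool" where
  "adic_complete R I \<longleftrightarrow>
     (\<Inter>L. ideal_power R I L) = {\<zero>\<^bsub>R\<^esub>} \<and>
     (\<forall>s. (\<forall>i. s i \<in> carrier R) \<and>
          (\<forall>L. \<exists>k. \<forall>i\<ge>k. \<forall>j\<ge>k. s i \<ominus>\<^bsub>R\<^esub> s j \<in> ideal_power R I L) \<longrightarrow>
        (\<exists>a. limitin (adic_topology R I) s a sequentially))"

definition max_ideal :: "('a, 'b) ring_scheme \<Rightarrow> 'a set" where
  "max_ideal R = (THE I. maximalideal I R)"

text \<open>The last assumption says that the kernel of the map from the integers to the residue field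
  is generated by \<^term>\<open>p\<close>.\<close>

locale pro_p_domain = noetherian_domain R for p :: nat and R (structure) +
  assumes prime_p: "prime p"
    and local: "\<exists>!I. maximalideal I R"
    and complete: "adic_complete R (max_ideal R)"
    and finite_residue_field: "finite (carrier (R Quot max_ideal R))"
    and residue_char: "\<And>n::nat. [n] \<cdot>\<^bsub>R Quot max_ideal R\<^esub> \<one>\<^bsub>R Quot max_ideal R\<^esub> = \<zero>\<^bsub>R Quot max_ideal R\<^esub>
      \<longleftrightarrow> p dvd n"

abbreviation m_power :: "('a, 'b) ring_scheme \<Rightarrow> nat \<Rightarrow> 'a set" where
  "m_power R L \<equiv> ideal_power R (max_ideal R) L"

abbreviation m_topology :: "('a, 'b) ring_scheme \<Rightarrow> 'a topology" where
  "m_topology R \<equiv> adic_topology R (max_ideal R)"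

text \<open>The $n$-tuples over a set are the extensional functions on \<^term>\<open>{..<n}\<close>.\<close>

definition tuples :: "nat \<Rightarrow> 'a set \<Rightarrow> (nat \<Rightarrow> 'a) set" where
  "tuples n X = {..<n} \<rightarrow>\<^sub>E X"

definition tuple_topology :: "('a, 'b) ring_scheme \<Rightarrow> nat \<Rightarrow> (nat \<Rightarrow> 'a) topology" where
  "tuple_topology R n = product_topology (\<lambda>_. m_topology R) {..<n}"

definition tuple_add ::
    "('a, 'b) ring_scheme \<Rightarrow> nat \<Rightarrow> (nat \<Rightarrow> 'a) \<Rightarrow> (nat \<Rightarrow> 'a) \<Rightarrow> nat \<Rightarrow> 'a" where
  "tuple_add R n x y = (\<lambda>i\<in>{..<n}. x i \<oplus>\<^bsub>R\<^esub> y i)"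

text \<open>A power series in $n$ variables is its family of coefficients, indexed by the exponents
  in \<^term>\<open>tuples n (UNIV :: nat set)\<close>; values at other arguments are irrelevant.\<close>

definition power_series :: "('a, 'b) ring_scheme \<Rightarrow> nat \<Rightarrow> ((nat \<Rightarrow> nat) \<Rightarrow> 'a) set" where
  "power_series R n = tuples n UNIV \<rightarrow> carrier R"

definition monomial_value ::
    "('a, 'b) ring_scheme \<Rightarrow> nat \<Rightarrow> (nat \<Rightarrow> nat) \<Rightarrow> (nat \<Rightarrow> 'a) \<Rightarrow> 'a" where
  "monomial_value R n e y = (\<Otimes>\<^bsub>R\<^esub>i\<in>{..<n}. y i [^]\<^bsub>R\<^esub> e i)"

text \<open>The value of a power series is the limit of its truncations by total degree.\<close>

definition power_series_has_value ::
    "('a, 'b) ring_scheme \<Rightarrow> nat \<Rightarrow> ((nat \<Rightarrow> nat) \<Rightarrow> 'a) \<Rightarrow> (nat \<Rightarrow> 'a) \<Rightarrow> 'a \<Rightarrow> bool" where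
  "power_series_has_value R n F y v \<longleftrightarrow>
     limitin (m_topology R)
       (\<lambda>d. \<Oplus>\<^bsub>R\<^esub>e\<in>{e \<in> tuples n UNIV. (\<Sum>i<n. e i) < d}. F e \<otimes>\<^bsub>R\<^esub> monomial_value R n e y)
       v sequentially"

definition analytic_map ::
    "('a, 'b) ring_scheme \<Rightarrow> nat \<Rightarrow> nat \<Rightarrow> (nat \<Rightarrow> 'a) set \<Rightarrow> ((nat \<Rightarrow> 'a) \<Rightarrow> nat \<Rightarrow> 'a) \<Rightarrow> bool" where
  "analytic_map R n m U f \<longleftrightarrow>
     openin (tuple_topology R n) U \<and> f \<in> U \<rightarrow> tuples m (carrier R) \<and>
     (\<forall>x\<in>U. \<exists>L>0. tuple_add R n x ` tuples n (m_power R L) \<subseteq> U \<and>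
        (\<exists>F \<in> tuples m (power_series R n). \<forall>y \<in> tuples n (m_power R L). \<forall>j<m.
           power_series_has_value R n (F j) y (f (tuple_add R n x y) j)))"

text \<open>A chart is a triple of its domain, its coordinate map (relevant on the domain only) and its
  dimension. A manifold is a topological space with a set of pairwise compatible charts covering
  it; this set need not be maximal, and overlapping charts are not required to have equal
  dimensions.\<close>

type_synonym ('a, 'm) chart = "'m set \<times> ('m \<Rightarrow> nat \<Rightarrow> 'a) \<times> nat"

definition is_chart :: "('a, 'b) ring_scheme \<Rightarrow> 'm topology \<Rightarrow> ('a, 'm) chart \<Rightarrow> bool" where
  "is_chart R M = (\<lambda>(U, \<phi>, n). openin M U \<and> openin (tuple_topology R n) (\<phi> ` U) \<and>
     homeomorphic_map (subtopology M U) (subtopology (tuple_topology R n) (\<phi> ` U)) \<phi>)"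

definition compatible :: "('a, 'b) ring_scheme \<Rightarrow> ('a, 'm) chart \<Rightarrow> ('a, 'm) chart \<Rightarrow> bool" where
  "compatible R = (\<lambda>(U, \<phi>, n) (V, \<psi>, m). U \<inter> V \<noteq> {} \<longrightarrow>
     analytic_map R m n (\<psi> ` (U \<inter> V)) (\<phi> \<circ> inv_into V \<psi>))"

definition analytic_manifold ::
    "('a, 'b) ring_scheme \<Rightarrow> 'm topology \<Rightarrow> ('a, 'm) chart set \<Rightarrow> bool" where
  "analytic_manifold R M A \<longleftrightarrow>
     (\<forall>c\<in>A. is_chart R M c) \<and>
     (\<forall>x \<in> topspace M. \<exists>(U, \<phi>, n) \<in> A. x \<in> U) \<and>
     (\<forall>c\<in>A. \<forall>d\<in>A. compatible R c d)"

definition manifold_analytic_map ::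
    "('a, 'b) ring_scheme \<Rightarrow> 'm topology \<Rightarrow> ('a, 'm) chart set \<Rightarrow> 'n topology \<Rightarrow> ('a, 'n) chart set
      \<Rightarrow> ('m \<Rightarrow> 'n) \<Rightarrow> bool" where
  "manifold_analytic_map R M A N B F \<longleftrightarrow>
     F \<in> topspace M \<rightarrow> topspace N \<and>
     (\<forall>x \<in> topspace M. \<exists>(U, \<phi>, m) \<in> A. \<exists>(V, \<psi>, n) \<in> B. x \<in> U \<and> F x \<in> V \<and>
        openin M {z \<in> topspace M. F z \<in> V} \<and>
        analytic_map R m n (\<phi> ` (U \<inter> {z \<in> topspace M. F z \<in> V})) (\<psi> \<circ> F \<circ> inv_into U \<phi>))"

end

theory Submission
  imports Defs
begin

text \<open>
  The image of \<open>F\<close> is finite because \<open>F\<close> is locally constant and \<open>M\<close> is compact. Local constancy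
  follows from a dichotomy: a map given on a ball by convergent power series is either constant
  there or takes at least continuum many values.

  For the dichotomy, suppose that one coordinate \<open>h\<close> of the map, given by a power series on
  \<open>(\<mm>\<^sup>L)\<^sup>n\<close> with \<open>L > 0\<close>, has \<open>h y \<noteq> h 0\<close>. Restrict \<open>h\<close> to the line through \<open>y\<close>:
  \<open>g s = h (s y)\<close> is defined for every \<open>s\<close> in \<open>R\<close>, since \<open>s y\<close> stays in the ball, and it is a power
  series in \<open>s\<close> whose \<open>k\<close>-th coefficient, the homogeneous part of degree \<open>k\<close> at \<open>y\<close>, lies in
  \<open>\<mm>\<^sup>k\<close>. Thus \<open>n\<close> variables reduce to one, with \<open>g 1 \<noteq> g 0\<close>.

  Such a \<open>g\<close> can be expanded around every \<open>t\<close>, and the new series again has its \<open>k\<close>-th coefficient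
  in \<open>\<mm>\<^sup>k\<close> and represents \<open>g\<close> on all of \<open>R\<close> (\<open>recentre\<close>). Hence its coefficients of positive
  degree do not all vanish, and if \<open>b\<^sub>k\<close> with \<open>k > 0\<close> is the first that does not, then
  \<open>g (t + u) - g t = u\<^sup>k (b\<^sub>k + u w)\<close> for some \<open>w\<close>. As \<open>R\<close> is a domain, this is nonzero as soon as
  \<open>u \<noteq> 0\<close> lies in a power of \<open>\<mm>\<close> that does not contain \<open>b\<^sub>k\<close> (\<open>locally_avoids_value\<close>). Using
  the first nonvanishing coefficient instead of the derivative also covers series in \<open>s\<^sup>p\<close> over a ring
  of characteristic \<open>p\<close>, whose derivative is zero.

  So every \<open>t\<close> has points arbitrarily close to it at which \<open>g\<close> takes another value. Since \<open>g\<close> is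
  continuous and \<open>R\<close> is complete, a binary tree of shrinking balls with pairwise separated images
  yields one value of \<open>g\<close> for each set of natural numbers (\<open>cantor_scheme\<close>).
\<close>

section \<open>Congruences and limits in a complete adic domain\<close>

text \<open>The ideal \<open>I\<close> stands for the maximal ideal of a pro-\<open>p\<close> domain. Completeness supplies the limits
  along the branches of a Cantor scheme, and the absence of zero divisors makes the fibres of a
  nonconstant power series discrete.\<close>

locale complete_adic_domain = "domain" R for R (structure) +
  fixes I
  assumes ideal_I: "ideal I R"
    and complete_I: "adic_complete R I"
begin

definition Ipow :: "nat \<Rightarrow> 'a set" where
  "Ipow L = ideal_power R I L"

lemma ideal_Ipow: "ideal (Ipow L) R"
  unfolding Ipow_def by (rule ideal_power_ideal[OF ring_axioms ideal_I])

lemma Ipow_antimono: "L \<le> L' \<Longrightarrow> Ipow L' \<subseteq> Ipow L"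
  unfolding Ipow_def by (rule ideal_power_antimono[OF ring_axioms ideal_I])

lemma Ipow_carrier [simp]: "x \<in> Ipow L \<Longrightarrow> x \<in> carrier R"
  using ideal.Icarr[OF ideal_Ipow] .

lemma Ipow_0: "Ipow 0 = carrier R"
  by (simp add: Ipow_def ideals_set_def nat_pow_def)

lemma Ipow_Suc: "Ipow (Suc L) = Ipow L \<cdot> I"
  by (simp only: Ipow_def ideal_power_Suc)

lemma Ipow_zero [simp]: "\<zero> \<in> Ipow L"
  using additive_subgroup.zero_closed[OF ideal.axioms(1)[OF ideal_Ipow]] .

lemma Ipow_add: "x \<in> Ipow L \<Longrightarrow> y \<in> Ipow L \<Longrightarrow> x \<oplus> y \<in> Ipow L"
  using additive_subgroup.a_closed[OF ideal.axioms(1)[OF ideal_Ipow]] .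

lemma Ipow_uminus: "x \<in> Ipow L \<Longrightarrow> \<ominus> x \<in> Ipow L"
  using additive_subgroup.a_inv_closed[OF ideal.axioms(1)[OF ideal_Ipow]] .

lemma Ipow_lmult: "x \<in> Ipow L \<Longrightarrow> y \<in> carrier R \<Longrightarrow> y \<otimes> x \<in> Ipow L"
  using ideal.I_l_closed[OF ideal_Ipow] .

lemma Ipow_rmult: "x \<in> Ipow L \<Longrightarrow> y \<in> carrier R \<Longrightarrow> x \<otimes> y \<in> Ipow L"
  using ideal.I_r_closed[OF ideal_Ipow] .

lemma Ipow_mult:
  assumes x: "x \<in> Ipow a" and y: "y \<in> Ipow b"
  shows "x \<otimes> y \<in> Ipow (a + b)"
  using y
proof (induction b arbitrary: y)
  case 0
  then show ?case using Ipow_rmult[OF x] by (simp add: Ipow_0)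
next
  case (Suc b)
  from Suc.prems have "y \<in> Ipow b \<cdot> I" by (simp only: Ipow_Suc)
  then have "x \<otimes> y \<in> Ipow (a + b) \<cdot> I \<and> y \<in> carrier R"
  proof (induction y rule: ideal_prod.induct)
    case (prod z w)
    have w: "w \<in> carrier R" using prod ideal.Icarr[OF ideal_I] by blast
    have "(x \<otimes> z) \<otimes> w \<in> Ipow (a + b) \<cdot> I"
      using Suc.IH prod by (blast intro: ideal_prod.prod)
    then show ?case using x prod w by (simp add: m_assoc)
  next
    case (sum s1 s2)
    then have "x \<otimes> s1 \<oplus> x \<otimes> s2 \<in> Ipow (a + b) \<cdot> I" by (blast intro: ideal_prod.sum)
    then show ?case using sum x by (simp add: r_distr)
  qed
  then show ?case by (simp add: Ipow_Suc)
qed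

lemma Ipow_pos_subset: "L > 0 \<Longrightarrow> Ipow L \<subseteq> I"
  using ideal_prod_inter[OF ideal_Ipow ideal_I] by (cases L) (auto simp: Ipow_Suc)

lemma I_subset_Ipow: "I \<subseteq> Ipow (Suc 0)"
proof
  fix x assume x: "x \<in> I"
  then have "\<one> \<otimes> x \<in> Ipow 0 \<cdot> I" by (intro ideal_prod.prod) (auto simp: Ipow_0)
  then show "x \<in> Ipow (Suc 0)"
    using x ideal.Icarr[OF ideal_I x] by (simp add: Ipow_Suc)
qed

lemma pow_in_Ipow: "x \<in> I \<Longrightarrow> x [^] (k::nat) \<in> Ipow k"
proof (induction k)
  case 0
  then show ?case by (simp add: Ipow_0)
next
  case (Suc k)
  then have "x [^] k \<otimes> x \<in> Ipow (k + Suc 0)"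
    using I_subset_Ipow by (intro Ipow_mult) auto
  then show ?case by simp
qed

lemma Inter_Ipow: "(\<And>L. x \<in> Ipow L) \<Longrightarrow> x = \<zero>"
  using complete_I unfolding adic_complete_def Ipow_def by blast

text \<open>Convergence is handled through congruences modulo the powers of \<open>I\<close>. Membership in the carrier is
  included so that the relation can be chained without side conditions.\<close>

definition eqmod :: "nat \<Rightarrow> 'a \<Rightarrow> 'a \<Rightarrow> bool" where
  "eqmod L x y \<longleftrightarrow> x \<in> carrier R \<and> y \<in> carrier R \<and> x \<ominus> y \<in> Ipow L"

lemma eqmodD: "eqmod L x y \<Longrightarrow> x \<in> carrier R" "eqmod L x y \<Longrightarrow> y \<in> carrier R"
  by (auto simp: eqmod_def)

lemma eqmod_refl [simp]: "x \<in> carrier R \<Longrightarrow> eqmod L x x"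
  by (simp add: eqmod_def a_minus_def r_neg)

lemma eqmod_sym: "eqmod L x y \<Longrightarrow> eqmod L y x"
  using Ipow_uminus[of "x \<ominus> y" L] minus_add
  by (auto simp: eqmod_def a_minus_def a_comm)

lemma eqmod_trans:
  assumes "eqmod L x y" "eqmod L y z"
  shows "eqmod L x z"
proof -
  have c: "x \<in> carrier R" "y \<in> carrier R" "z \<in> carrier R" using assms by (auto simp: eqmod_def)
  then have "x \<ominus> z = (x \<ominus> y) \<oplus> (y \<ominus> z)" by algebra
  then show ?thesis using c assms Ipow_add by (simp add: eqmod_def)
qed

lemma eqmod_add:
  assumes "eqmod L x y" "eqmod L x' y'"
  shows "eqmod L (x \<oplus> x') (y \<oplus> y')"
proof -
  have c: "x \<in> carrier R" "y \<in> carrier R" "x' \<in> carrier R" "y' \<in> carrier R"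
    using assms by (auto simp: eqmod_def)
  then have "(x \<oplus> x') \<ominus> (y \<oplus> y') = (x \<ominus> y) \<oplus> (x' \<ominus> y')" by algebra
  then show ?thesis using c assms Ipow_add by (simp add: eqmod_def)
qed

lemma eqmod_mult:
  assumes "eqmod L x y" "eqmod L x' y'"
  shows "eqmod L (x \<otimes> x') (y \<otimes> y')"
proof -
  have c: "x \<in> carrier R" "y \<in> carrier R" "x' \<in> carrier R" "y' \<in> carrier R"
    using assms by (auto simp: eqmod_def)
  then have "(x \<otimes> x') \<ominus> (y \<otimes> y') = (x \<ominus> y) \<otimes> x' \<oplus> y \<otimes> (x' \<ominus> y')" by algebra
  then show ?thesis using c assms Ipow_add Ipow_lmult Ipow_rmult by (simp add: eqmod_def)
qed

lemma eqmod_power: "eqmod L x y \<Longrightarrow> eqmod L (x [^] (k::nat)) (y [^] k)"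
  by (induction k) (auto intro: eqmod_mult)

lemma eqmod_zero_iff: "eqmod L x \<zero> \<longleftrightarrow> x \<in> Ipow L"
  by (auto simp: eqmod_def a_minus_def)

lemma eqmod_antimono: "L \<le> L' \<Longrightarrow> eqmod L' x y \<Longrightarrow> eqmod L x y"
  using Ipow_antimono unfolding eqmod_def by blast

lemma eqmod_add_Ipow: "x \<in> carrier R \<Longrightarrow> u \<in> Ipow L \<Longrightarrow> eqmod L (x \<oplus> u) x"
  using eqmod_add[of L x x u \<zero>] by (simp add: eqmod_zero_iff)

lemma eqmod_all_imp_eq: "(\<And>L. eqmod L x y) \<Longrightarrow> x = y"
  using Inter_Ipow[of "x \<ominus> y"] r_right_minus_eq[of x y] by (auto simp: eqmod_def)

lemma mem_coset_Ipow_iff: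
  assumes "x \<in> carrier R"
  shows "z \<in> x <+ Ipow L \<longleftrightarrow> eqmod L z x"
proof
  assume "z \<in> x <+ Ipow L"
  then show "eqmod L z x" using assms eqmod_add_Ipow by (auto simp: a_l_coset_defs)
next
  assume z: "eqmod L z x"
  then have "z = x \<oplus> (z \<ominus> x)" using assms by (auto simp: eqmod_def) algebra
  then show "z \<in> x <+ Ipow L" using z by (auto simp: a_l_coset_defs eqmod_def)
qed

lemma openin_adic: "openin (adic_topology R I) U \<longleftrightarrow>
    U \<subseteq> carrier R \<and> (\<forall>x\<in>U. \<exists>L. x <+ Ipow L \<subseteq> U)"
  unfolding Ipow_def by (rule openin_adic_topology[OF ring_axioms ideal_I])

lemma openin_coset:
  assumes "x \<in> carrier R"
  shows "openin (adic_topology R I) (x <+ Ipow L)"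
  unfolding openin_adic
proof (intro conjI ballI)
  show "x <+ Ipow L \<subseteq> carrier R"
    using mem_coset_Ipow_iff[OF assms] eqmodD by blast
  fix z assume "z \<in> x <+ Ipow L"
  then have z: "eqmod L z x" by (simp add: mem_coset_Ipow_iff assms)
  then have "z <+ Ipow L \<subseteq> x <+ Ipow L"
    using eqmod_trans[OF _ z] eqmodD(1)[OF z] by (auto simp: mem_coset_Ipow_iff assms)
  then show "\<exists>L'. z <+ Ipow L' \<subseteq> x <+ Ipow L" ..
qed

lemma topspace_adic: "topspace (adic_topology R I) = carrier R"
proof
  have "openin (adic_topology R I) (carrier R)"
    unfolding openin_adic using openin_coset openin_adic by blast
  then show "carrier R \<subseteq> topspace (adic_topology R I)" by (rule openin_subset)
  show "topspace (adic_topology R I) \<subseteq> carrier R"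
    using openin_topspace[of "adic_topology R I"] unfolding openin_adic by blast
qed

lemma eqmod_telescope:
  assumes "\<And>D. eqmod D (s (Suc D)) (s D)" and "D \<le> D'"
  shows "eqmod D (s D') (s D)"
  using assms(2)
proof (induction D' rule: dec_induct)
  case base
  then show ?case using assms(1)[of D] eqmodD(2) by simp
next
  case (step n)
  then show ?case using eqmod_antimono[OF step(1) assms(1)] eqmod_trans by blast
qed

text \<open>A series whose \<open>D\<close>-th term lies in \<open>I\<^sup>D\<close> has partial sums that approximate the limit at a known
  rate: the congruence class of the limit modulo \<open>I\<^sup>D\<close> is already that of the \<open>D\<close>-th partial sum. From
  here on congruences with partial sums replace topological limits.\<close>

lemma limitin_eqmod:
  assumes s: "\<And>D. eqmod D (s (Suc D)) (s D)"
    and lim: "limitin (adic_topology R I) s v sequentially"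
  shows "eqmod D v (s D)"
proof -
  have v: "v \<in> carrier R" using lim by (simp add: limitin_def topspace_adic)
  have "v \<in> v <+ Ipow D" using v by (simp add: mem_coset_Ipow_iff)
  then have "eventually (\<lambda>n. s n \<in> v <+ Ipow D) sequentially"
    using limitinD[OF lim openin_coset[OF v]] by blast
  then have "eventually (\<lambda>n. s n \<in> v <+ Ipow D \<and> n \<ge> D) sequentially"
    using eventually_ge_at_top by (rule eventually_conj)
  then obtain n where "s n \<in> v <+ Ipow D" "n \<ge> D"
    by (auto simp: eventually_sequentially)
  then show ?thesis
    using eqmod_telescope[OF s] by (meson mem_coset_Ipow_iff v eqmod_sym eqmod_trans)
qed

lemma eqmod_limit_exists:
  assumes s: "\<And>D. eqmod D (s (Suc D)) (s D)"
  shows "\<exists>v. \<forall>D. eqmod D v (s D)"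
proof -
  have "\<exists>k. \<forall>i\<ge>k. \<forall>j\<ge>k. s i \<ominus> s j \<in> Ipow L" for L
  proof (intro exI[of _ L] allI impI)
    fix i j assume "L \<le> i" "L \<le> j"
    then have "eqmod L (s i) (s j)"
      using eqmod_telescope[OF s] eqmod_sym eqmod_trans by meson
    then show "s i \<ominus> s j \<in> Ipow L" by (simp add: eqmod_def)
  qed
  moreover have "s i \<in> carrier R" for i using s eqmodD(2) by blast
  ultimately obtain v where "limitin (adic_topology R I) s v sequentially"
    using complete_I unfolding adic_complete_def Ipow_def by blast
  then show ?thesis using limitin_eqmod[OF s] by blast
qed

section \<open>Power series in one variable\<close>

definition partial_sum :: "(nat \<Rightarrow> 'a) \<Rightarrow> 'a \<Rightarrow> nat \<Rightarrow> 'a" where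
  "partial_sum c s D = (\<Oplus>k\<in>{..<D}. c k \<otimes> s [^] k)"

definition sums_to :: "(nat \<Rightarrow> 'a) \<Rightarrow> 'a \<Rightarrow> 'a \<Rightarrow> bool" where
  "sums_to c s v \<longleftrightarrow> (\<forall>D. eqmod D v (partial_sum c s D))"

text \<open>This decay makes the series converge at every \<open>s\<close> in \<open>R\<close>, at a rate independent of \<open>s\<close>. It holds for
  a series in several variables restricted to a line spanned by a tuple over \<open>I\<close>.\<close>

definition adic_coeffs :: "(nat \<Rightarrow> 'a) \<Rightarrow> bool" where
  "adic_coeffs c \<longleftrightarrow> (\<forall>k. c k \<in> Ipow k)"

lemma adic_coeffs_carrier: "adic_coeffs c \<Longrightarrow> c k \<in> carrier R"
  unfolding adic_coeffs_def using Ipow_carrier by blast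

lemma partial_sum_0 [simp]: "partial_sum c s 0 = \<zero>"
  by (simp add: partial_sum_def)

lemma partial_sum_Suc:
  assumes "\<And>k. c k \<in> carrier R" "s \<in> carrier R"
  shows "partial_sum c s (Suc D) = partial_sum c s D \<oplus> c D \<otimes> s [^] D"
  using assms unfolding partial_sum_def lessThan_Suc
  by (subst finsum_insert) (auto simp: a_comm)

lemma partial_sum_closed:
  assumes "\<And>k. c k \<in> carrier R" "s \<in> carrier R"
  shows "partial_sum c s D \<in> carrier R"
  using assms unfolding partial_sum_def by (intro finsum_closed) auto

lemma partial_sum_step:
  assumes "adic_coeffs c" "s \<in> carrier R"
  shows "eqmod D (partial_sum c s (Suc D)) (partial_sum c s D)"
  using assms adic_coeffs_carrier[OF assms(1)] partial_sum_closed[of c s D]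
  by (simp add: partial_sum_Suc eqmod_add_Ipow Ipow_rmult adic_coeffs_def)

lemma partial_sum_split:
  assumes c: "\<And>k. c k \<in> carrier R" and s: "s \<in> carrier R"
  shows "partial_sum c s (Suc D) = c 0 \<oplus> s \<otimes> partial_sum (\<lambda>k. c (Suc k)) s D"
proof (induction D)
  case 0
  then show ?case using c s by (simp add: partial_sum_Suc)
next
  case (Suc D)
  define p where "p = partial_sum (\<lambda>k. c (Suc k)) s D"
  have p: "p \<in> carrier R" using c s by (auto simp: p_def intro: partial_sum_closed)
  have "partial_sum c s (Suc (Suc D)) = (c 0 \<oplus> s \<otimes> p) \<oplus> c (Suc D) \<otimes> (s [^] D \<otimes> s)"
    by (subst partial_sum_Suc[OF c s]) (simp add: Suc p_def)
  also have "\<dots> = c 0 \<oplus> s \<otimes> (p \<oplus> c (Suc D) \<otimes> s [^] D)"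
  proof -
    have "c 0 \<in> carrier R" "c (Suc D) \<in> carrier R" "s [^] D \<in> carrier R" using c s by auto
    then show ?thesis using p s by algebra
  qed
  also have "\<dots> = c 0 \<oplus> s \<otimes> partial_sum (\<lambda>k. c (Suc k)) s (Suc D)"
    using c s by (simp add: partial_sum_Suc p_def)
  finally show ?case .
qed

lemma sums_to_closed: "sums_to c s v \<Longrightarrow> v \<in> carrier R"
  unfolding sums_to_def using eqmodD(1) by blast

lemma sums_to_exists:
  assumes "adic_coeffs c" "s \<in> carrier R"
  obtains v where "v \<in> carrier R" "sums_to c s v"
  using eqmod_limit_exists[of "partial_sum c s"] partial_sum_step[OF assms] eqmodD(1)
  unfolding sums_to_def by metis

text \<open>The shift by one fits the comparison with a partial sum from which the constant term has been split
  off.\<close>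

lemma eqmod_limit_unique_Suc:
  assumes "\<And>D. eqmod D v (x (Suc D))" "\<And>D. eqmod D w (x (Suc D))"
  shows "v = w"
  using assms eqmod_all_imp_eq eqmod_sym eqmod_trans by meson

lemma adic_coeffs_Suc: "adic_coeffs c \<Longrightarrow> adic_coeffs (\<lambda>k. c (Suc k))"
  unfolding adic_coeffs_def using Ipow_antimono[OF le_SucI[OF order_refl]] by blast

lemma sums_to_split:
  assumes c: "adic_coeffs c" and s: "s \<in> carrier R" and v: "sums_to c s v"
  obtains w where "sums_to (\<lambda>k. c (Suc k)) s w" "v = c 0 \<oplus> s \<otimes> w"
proof -
  obtain w where w: "w \<in> carrier R" "sums_to (\<lambda>k. c (Suc k)) s w"
    using sums_to_exists[OF adic_coeffs_Suc[OF c] s] by blast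
  have "v = c 0 \<oplus> s \<otimes> w"
  proof (rule eqmod_limit_unique_Suc)
    fix D
    show "eqmod D v (partial_sum c s (Suc D))"
      using v eqmod_antimono[of D "Suc D"] by (auto simp: sums_to_def)
    have "eqmod D (c 0 \<oplus> s \<otimes> w) (c 0 \<oplus> s \<otimes> partial_sum (\<lambda>k. c (Suc k)) s D)"
      using w s adic_coeffs_carrier[OF c] by (auto simp: sums_to_def intro!: eqmod_add eqmod_mult)
    then show "eqmod D (c 0 \<oplus> s \<otimes> w) (partial_sum c s (Suc D))"
      using adic_coeffs_carrier[OF c] s by (simp add: partial_sum_split)
  qed
  then show ?thesis using that w by blast
qed

text \<open>Splitting off the constant term \<open>k\<close> times turns the vanishing of the first \<open>k\<close> coefficients into
  divisibility of the value by \<open>s\<^sup>k\<close>.\<close>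

lemma sums_to_split_power:
  assumes "adic_coeffs c" "s \<in> carrier R" "sums_to c s v" "\<And>j. j < k \<Longrightarrow> c j = \<zero>"
  shows "\<exists>w\<in>carrier R. v = s [^] k \<otimes> (c k \<oplus> s \<otimes> w)"
  using assms
proof (induction k arbitrary: c v)
  case 0
  obtain w where w: "sums_to (\<lambda>k. c (Suc k)) s w" "v = c 0 \<oplus> s \<otimes> w"
    using sums_to_split[OF 0(1-3)] by blast
  then have "w \<in> carrier R" using sums_to_closed by blast
  then show ?case using w 0(2) adic_coeffs_carrier[OF 0(1)] by auto
next
  case (Suc k)
  obtain w where w: "sums_to (\<lambda>k. c (Suc k)) s w" "v = c 0 \<oplus> s \<otimes> w"
    using sums_to_split[OF Suc.prems(1-3)] by blast
  obtain w' where w': "w' \<in> carrier R" "w = s [^] k \<otimes> (c (Suc k) \<oplus> s \<otimes> w')"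
    using Suc.IH[OF adic_coeffs_Suc[OF Suc.prems(1)] Suc.prems(2) w(1)] Suc.prems(4) by auto
  have "c 0 = \<zero>" using Suc.prems(4) by simp
  moreover have "c (Suc k) \<in> carrier R" "s [^] k \<in> carrier R"
    using adic_coeffs_carrier[OF Suc.prems(1)] Suc.prems(2) by auto
  ultimately have "v = s [^] Suc k \<otimes> (c (Suc k) \<oplus> s \<otimes> w')"
    unfolding w(2) w'(2) nat_pow_Suc using Suc.prems(2) w'(1) by algebra
  then show ?case using w'(1) by blast
qed

lemma sums_to_at_zero:
  assumes "adic_coeffs c" "sums_to c \<zero> v"
  shows "v = c 0"
proof -
  obtain w where "sums_to (\<lambda>k. c (Suc k)) \<zero> w" "v = c 0 \<oplus> \<zero> \<otimes> w"
    using sums_to_split[OF assms(1) zero_closed assms(2)] by blast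
  then show ?thesis using sums_to_closed adic_coeffs_carrier[OF assms(1)] by auto
qed

lemma sums_to_constant:
  assumes c: "adic_coeffs c" and s: "s \<in> carrier R" and v: "sums_to c s v"
    and zero: "\<And>k. c (Suc k) = \<zero>"
  shows "v = c 0"
proof -
  obtain w where w: "sums_to (\<lambda>k. c (Suc k)) s w" "v = c 0 \<oplus> s \<otimes> w"
    using sums_to_split[OF c s v] by blast
  have "partial_sum (\<lambda>k. c (Suc k)) s D = \<zero>" for D
    using s by (induction D) (auto simp: zero partial_sum_Suc)
  then have "w = \<zero>" using w(1) eqmod_all_imp_eq[of w \<zero>] by (simp add: sums_to_def)
  then show ?thesis using w(2) s adic_coeffs_carrier[OF c] by simp
qed

lemma partial_sum_eqmod:
  assumes c: "\<And>k. c k \<in> carrier R" and xy: "eqmod L x y"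
  shows "eqmod L (partial_sum c x D) (partial_sum c y D)"
  using c eqmodD[OF xy] eqmod_power[OF xy]
  by (induction D) (auto simp: partial_sum_Suc intro!: eqmod_add eqmod_mult)

lemma sums_to_continuous:
  assumes c: "adic_coeffs c" and "sums_to c x v" "sums_to c y w" and xy: "eqmod L x y"
  shows "eqmod L v w"
  using assms(2,3) partial_sum_eqmod[of c, OF adic_coeffs_carrier[OF c] xy] eqmod_sym eqmod_trans
  unfolding sums_to_def by meson

text \<open>The coefficient of \<open>u\<^sup>k\<close> in \<open>(t + u)\<^sup>j\<close>, computed by Pascal's recursion.\<close>

primrec shifted_power_coeff :: "'a \<Rightarrow> nat \<Rightarrow> nat \<Rightarrow> 'a" where
  "shifted_power_coeff t 0 = (\<lambda>k. if k = 0 then \<one> else \<zero>)"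
| "shifted_power_coeff t (Suc j) = (\<lambda>k. t \<otimes> shifted_power_coeff t j k \<oplus>
     (case k of 0 \<Rightarrow> \<zero> | Suc i \<Rightarrow> shifted_power_coeff t j i))"

lemma shifted_power_coeff_closed:
  "t \<in> carrier R \<Longrightarrow> shifted_power_coeff t j k \<in> carrier R"
  by (induction j arbitrary: k) (auto split: nat.split)

lemma shifted_power_coeff_eq_zero:
  "t \<in> carrier R \<Longrightarrow> j < k \<Longrightarrow> shifted_power_coeff t j k = \<zero>"
  by (induction j arbitrary: k) (auto split: nat.split)

lemma partial_sum_add:
  assumes "\<And>k. a k \<in> carrier R" "\<And>k. b k \<in> carrier R" "u \<in> carrier R"
  shows "partial_sum (\<lambda>k. a k \<oplus> b k) u D = partial_sum a u D \<oplus> partial_sum b u D"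
proof (induction D)
  case (Suc D)
  have "partial_sum a u D \<in> carrier R" "partial_sum b u D \<in> carrier R"
    using assms by (auto intro: partial_sum_closed)
  then show ?case using assms by (simp add: partial_sum_Suc Suc l_distr a_ac)
qed simp

lemma partial_sum_scale:
  assumes "\<And>k. a k \<in> carrier R" "t \<in> carrier R" "u \<in> carrier R"
  shows "partial_sum (\<lambda>k. t \<otimes> a k) u D = t \<otimes> partial_sum a u D"
  using assms partial_sum_closed[of a u]
  by (induction D) (auto simp: partial_sum_Suc r_distr m_assoc)

lemma shifted_power_expand:
  assumes t: "t \<in> carrier R" and u: "u \<in> carrier R"
  shows "partial_sum (shifted_power_coeff t j) u (Suc j) = (t \<oplus> u) [^] j"
proof (induction j)
  case 0
  then show ?case using u by (simp add: partial_sum_Suc)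
next
  case (Suc j)
  let ?p = "shifted_power_coeff t j"
  let ?q = "\<lambda>k. case k of 0 \<Rightarrow> \<zero> | Suc i \<Rightarrow> ?p i"
  have p: "?p k \<in> carrier R" for k using t by (rule shifted_power_coeff_closed)
  have q: "?q k \<in> carrier R" for k using p by (auto split: nat.split)
  have "partial_sum (shifted_power_coeff t (Suc j)) u (Suc (Suc j)) =
      t \<otimes> partial_sum ?p u (Suc (Suc j)) \<oplus> partial_sum ?q u (Suc (Suc j))"
    using p q t u by (simp add: partial_sum_add partial_sum_scale)
  also have "partial_sum ?p u (Suc (Suc j)) = (t \<oplus> u) [^] j"
    using Suc p u t by (subst partial_sum_Suc) (auto simp: shifted_power_coeff_eq_zero)
  also have "partial_sum ?q u (Suc (Suc j)) = u \<otimes> partial_sum ?p u (Suc j)"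
    using q u p partial_sum_closed[of ?p u "Suc j"] by (subst partial_sum_split) auto
  also have "\<dots> = u \<otimes> (t \<oplus> u) [^] j" by (simp only: Suc)
  also have "t \<otimes> (t \<oplus> u) [^] j \<oplus> u \<otimes> (t \<oplus> u) [^] j = (t \<oplus> u) [^] Suc j"
    using t u by (simp add: l_distr[symmetric] m_comm)
  finally show ?case .
qed

text \<open>The coefficient \<open>b\<^sub>k\<close> of the expansion around \<open>t\<close> is the limit of the coefficients of \<open>u\<^sup>k\<close> in the
  truncations \<open>\<Sum>j<D. c\<^sub>j (t + u)\<^sup>j\<close>. Passing from one truncation to the next changes every coefficient
  by an element of \<open>I\<^sup>D\<close>, so modulo \<open>I\<^sup>D\<close> the series in \<open>u\<close> is the \<open>D\<close>-th truncation, where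
  the rearrangement in powers of \<open>u\<close> is an identity of polynomials.\<close>

lemma recentre:
  assumes c: "adic_coeffs c" and t: "t \<in> carrier R"
  obtains b where "adic_coeffs b"
    "\<And>u v. u \<in> carrier R \<Longrightarrow> sums_to c (t \<oplus> u) v \<Longrightarrow> sums_to b u v"
proof -
  let ?p = "shifted_power_coeff t"
  \<comment> \<open>\<open>q D k\<close> is the coefficient of \<open>u\<^sup>k\<close> in \<open>\<Sum>j<D. c\<^sub>j (t + u)\<^sup>j\<close>.\<close>
  define q where "q = rec_nat (\<lambda>k. \<zero>) (\<lambda>D f k. f k \<oplus> c D \<otimes> ?p D k)"
  have q_0: "q 0 = (\<lambda>k. \<zero>)" and q_Suc: "q (Suc D) = (\<lambda>k. q D k \<oplus> c D \<otimes> ?p D k)" for D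
    by (auto simp: q_def)
  have p: "?p j k \<in> carrier R" for j k using t by (rule shifted_power_coeff_closed)
  have cc: "c k \<in> carrier R" for k using c by (rule adic_coeffs_carrier)
  have qc: "q D k \<in> carrier R" for D k
    by (induction D) (auto simp: q_0 q_Suc p cc)
  \<comment> \<open>A power \<open>(t + u)\<^sup>j\<close> contributes to \<open>u\<^sup>k\<close> only if \<open>k \<le> j\<close>, and then \<open>c\<^sub>j\<close> lies in \<open>I\<^sup>k\<close>.\<close>
  have qk: "q D k \<in> Ipow k" for D k
  proof (induction D)
    case (Suc D)
    have "c D \<otimes> ?p D k \<in> Ipow k"
    proof (cases "D < k")
      case True
      then show ?thesis using cc t by (simp add: shifted_power_coeff_eq_zero)
    next
      case False
      then have "c D \<in> Ipow k" using c Ipow_antimono[of k D] by (auto simp: adic_coeffs_def)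
      then show ?thesis using p by (rule Ipow_rmult)
    qed
    then show ?case using Suc by (simp add: q_Suc Ipow_add)
  qed (simp add: q_0)
  have qD: "q D k = \<zero>" if "D \<le> k" for D k
    using that by (induction D) (auto simp: q_0 q_Suc shifted_power_coeff_eq_zero t cc)
  have step: "eqmod D (q (Suc D) k) (q D k)" for D k
    using c p qc by (simp add: q_Suc eqmod_add_Ipow Ipow_rmult adic_coeffs_def)
  have "\<exists>v. \<forall>D. eqmod D v (q D k)" for k
    using step by (rule eqmod_limit_exists)
  then obtain b where b: "\<And>k D. eqmod D (b k) (q D k)" by metis
  have bc: "b k \<in> carrier R" for k using b eqmodD(1) by blast
  have "adic_coeffs b"
    unfolding adic_coeffs_def
  proof
    fix k
    have "eqmod k (q k k) \<zero>" using qk by (simp add: eqmod_zero_iff)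
    then show "b k \<in> Ipow k" using b[of k k] eqmod_trans eqmod_zero_iff by blast
  qed
  moreover have "sums_to b u v" if u: "u \<in> carrier R" and v: "sums_to c (t \<oplus> u) v" for u v
    unfolding sums_to_def
  proof
    fix D
    have poly: "partial_sum (q D) u D = partial_sum c (t \<oplus> u) D"
    proof (induction D)
      case (Suc D)
      have "partial_sum (q (Suc D)) u (Suc D) =
          partial_sum (q D) u (Suc D) \<oplus> c D \<otimes> partial_sum (?p D) u (Suc D)"
        using qc cc p u by (simp add: q_Suc partial_sum_add partial_sum_scale)
      also have "partial_sum (q D) u (Suc D) = partial_sum (q D) u D"
        using qc u partial_sum_closed[of "q D" u D] by (simp add: partial_sum_Suc qD)
      finally show ?case
        using Suc cc t u by (simp add: shifted_power_expand partial_sum_Suc)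
    qed simp
    have "eqmod D (partial_sum (q D) u D') (partial_sum b u D')" for D'
      using qc bc u eqmod_sym[OF b]
      by (induction D') (auto simp: partial_sum_Suc intro!: eqmod_add eqmod_mult)
    then show "eqmod D v (partial_sum b u D)"
      using v poly unfolding sums_to_def by (metis eqmod_trans)
  qed
  ultimately show ?thesis by (rule that)
qed

text \<open>If all coefficients of positive degree in the expansion around \<open>t\<close> vanished, \<open>g\<close> would be constant on the
  whole of \<open>R\<close>, because this expansion is valid everywhere. With \<open>b\<^sub>k\<close> the first nonvanishing one,
  \<open>g (t + u) = g t\<close> for \<open>u \<noteq> 0\<close> forces \<open>b\<^sub>k\<close> to be a multiple of \<open>u\<close>, which fails once \<open>u\<close> lies in a
  power of \<open>I\<close> that does not contain \<open>b\<^sub>k\<close>.\<close>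

lemma locally_avoids_value:
  assumes c: "adic_coeffs c" and g: "\<And>s. s \<in> carrier R \<Longrightarrow> sums_to c s (g s)"
    and r: "r \<in> carrier R" "g r \<noteq> g \<zero>" and t: "t \<in> carrier R"
  shows "\<exists>N. \<forall>u\<in>Ipow N. u \<noteq> \<zero> \<longrightarrow> g (t \<oplus> u) \<noteq> g t"
proof -
  obtain b where b: "adic_coeffs b"
    and "\<And>u v. u \<in> carrier R \<Longrightarrow> sums_to c (t \<oplus> u) v \<Longrightarrow> sums_to b u v"
    using recentre[OF c t] by blast
  then have gb: "sums_to b u (g (t \<oplus> u))" if "u \<in> carrier R" for u
    using that g t by auto
  have bc: "b k \<in> carrier R" for k using b by (rule adic_coeffs_carrier)
  have "\<exists>k. b (Suc k) \<noteq> \<zero>"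
  proof (rule ccontr)
    assume "\<not> (\<exists>k. b (Suc k) \<noteq> \<zero>)"
    then have "g (t \<oplus> u) = b 0" if "u \<in> carrier R" for u
      using sums_to_constant[OF b that gb[OF that]] by blast
    \<comment> \<open>Constancy is tested at the displacements that lead from \<open>t\<close> to \<open>r\<close> and to zero.\<close>
    from this[of "r \<ominus> t"] this[of "\<zero> \<ominus> t"] have "g (t \<oplus> (r \<ominus> t)) = g (t \<oplus> (\<zero> \<ominus> t))"
      using r t by simp
    moreover have "t \<oplus> (r \<ominus> t) = r" "t \<oplus> (\<zero> \<ominus> t) = \<zero>" using r t by algebra+
    ultimately show False using r by simp
  qed
  then obtain k where k: "b (Suc k) \<noteq> \<zero>" "\<And>j. j < k \<Longrightarrow> b (Suc j) = \<zero>"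
    using exists_least_iff[of "\<lambda>k. b (Suc k) \<noteq> \<zero>"] by blast
  obtain N where N: "b (Suc k) \<notin> Ipow N" using Inter_Ipow k(1) by blast
  show ?thesis
  proof (intro exI[of _ N] ballI impI notI)
    fix u assume u: "u \<in> Ipow N" "u \<noteq> \<zero>" and eq: "g (t \<oplus> u) = g t"
    have uc: "u \<in> carrier R" using u by simp
    obtain w where w: "sums_to (\<lambda>k. b (Suc k)) u w" "g (t \<oplus> u) = b 0 \<oplus> u \<otimes> w"
      using sums_to_split[OF b uc gb[OF uc]] by blast
    have wc: "w \<in> carrier R" using w(1) sums_to_closed by blast
    have "g t = b 0" using sums_to_at_zero[OF b] gb[of \<zero>] t by simp
    then have "b 0 \<oplus> u \<otimes> w = b 0 \<oplus> \<zero>" using w(2) eq bc by simp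
    then have "u \<otimes> w = \<zero>" using bc uc wc by (metis add.l_cancel m_closed zero_closed)
    then have w0: "w = \<zero>" using u(2) uc wc integral_iff by blast
    obtain w' where w': "w' \<in> carrier R" "w = u [^] k \<otimes> (b (Suc k) \<oplus> u \<otimes> w')"
      using sums_to_split_power[OF adic_coeffs_Suc[OF b] uc w(1), of k] k(2) by blast
    have "u [^] k \<noteq> \<zero>" using u(2) uc by (induction k) (auto simp: integral_iff)
    then have "b (Suc k) \<oplus> u \<otimes> w' = \<zero>"
      using w0 w' uc bc integral_iff by (metis a_closed m_closed nat_pow_closed)
    then have "b (Suc k) = \<ominus> (u \<otimes> w')" using bc uc w'(1) by (metis m_closed minus_equality)
    then have "b (Suc k) \<in> Ipow N" using Ipow_uminus[OF Ipow_rmult[OF u(1) w'(1)]] by simp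
    then show False using N by blast
  qed
qed

section \<open>A Cantor scheme\<close>

text \<open>A set \<open>\<alpha>\<close> of natural numbers describes a branch: starting from zero, the \<open>i\<close>-th step moves the current
  centre to a nearby point with another value of \<open>g\<close> if \<open>i \<in> \<alpha>\<close>, and leaves it in place otherwise. In
  both cases the radius then shrinks so far that, by continuity, the values of \<open>g\<close> on the two new
  balls remain incongruent. Centres along a branch converge, and branches that part at step \<open>i\<close> end at
  points with different values.\<close>

lemma cantor_scheme:
  assumes cont: "\<And>L x y. eqmod L x y \<Longrightarrow> eqmod L (g x) (g y)"
    and sep: "\<And>x N. x \<in> carrier R \<Longrightarrow> \<exists>u\<in>Ipow N. g (x \<oplus> u) \<noteq> g x"
  shows "\<exists>T :: nat set \<Rightarrow> 'a. range T \<subseteq> carrier R \<and> inj (g \<circ> T)"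
proof -
  \<comment> \<open>\<open>N'\<close> is the exponent of the new radius; \<open>N < N'\<close> makes the centres converge.\<close>
  have "\<exists>u N'. u \<in> Ipow N \<and> N < N' \<and> \<not> eqmod N' (g (x \<oplus> u)) (g x)" if x: "x \<in> carrier R" for x N
  proof -
    obtain u where u: "u \<in> Ipow N" "g (x \<oplus> u) \<noteq> g x" using sep[OF x] by blast
    obtain L where L: "\<not> eqmod L (g (x \<oplus> u)) (g x)" using u(2) eqmod_all_imp_eq by blast
    have "\<not> eqmod (max L (Suc N)) (g (x \<oplus> u)) (g x)"
      using L eqmod_antimono[of L "max L (Suc N)"] by auto
    then show ?thesis using u(1) by (metis less_max_iff_disj lessI)
  qed
  then obtain U K where UK: "\<And>x N. x \<in> carrier R \<Longrightarrow>
      U x N \<in> Ipow N \<and> N < K x N \<and> \<not> eqmod (K x N) (g (x \<oplus> U x N)) (g x)"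
    by metis
  \<comment> \<open>A node is a centre together with the exponent of its radius.\<close>
  define node where "node \<alpha> = rec_nat (\<zero>, 0)
    (\<lambda>i (x, N). (if i \<in> \<alpha> then x \<oplus> U x N else x, K x N))" for \<alpha> :: "nat set"
  have node_0: "node \<alpha> 0 = (\<zero>, 0)" for \<alpha> by (simp add: node_def)
  have node_Suc: "node \<alpha> (Suc i) = (let (x, N) = node \<alpha> i in
      (if i \<in> \<alpha> then x \<oplus> U x N else x, K x N))" for \<alpha> i
    by (simp add: node_def Let_def)
  define x where "x \<alpha> i = fst (node \<alpha> i)" for \<alpha> i
  define N where "N \<alpha> i = snd (node \<alpha> i)" for \<alpha> i
  have x_Suc: "x \<alpha> (Suc i) = (if i \<in> \<alpha> then x \<alpha> i \<oplus> U (x \<alpha> i) (N \<alpha> i) else x \<alpha> i)"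
    and N_Suc: "N \<alpha> (Suc i) = K (x \<alpha> i) (N \<alpha> i)" for \<alpha> i
    by (auto simp: x_def N_def node_Suc split: prod.split)
  have xc: "x \<alpha> i \<in> carrier R" for \<alpha> i
  proof (induction i)
    case (Suc i)
    then have "U (x \<alpha> i) (N \<alpha> i) \<in> carrier R" using UK Ipow_carrier by blast
    then show ?case using Suc by (simp add: x_Suc)
  qed (simp add: x_def node_0)
  have N_less: "N \<alpha> i < N \<alpha> (Suc i)" for \<alpha> i using UK[OF xc] by (simp add: N_Suc)
  have N_mono: "i \<le> j \<Longrightarrow> N \<alpha> i \<le> N \<alpha> j" for \<alpha> i j
    using lift_Suc_mono_le[of "N \<alpha>"] N_less less_imp_le by blast
  have N_ge: "i \<le> N \<alpha> i" for \<alpha> i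
    by (induction i) (auto intro: order.strict_trans1[OF _ N_less] Suc_leI)
  have x_step: "eqmod (N \<alpha> i) (x \<alpha> (Suc i)) (x \<alpha> i)" for \<alpha> i
    using UK[OF xc] by (auto simp: x_Suc xc intro: eqmod_add_Ipow)
  have x_far: "eqmod (N \<alpha> i) (x \<alpha> j) (x \<alpha> i)" if "i \<le> j" for \<alpha> i j
    using that
  proof (induction j rule: dec_induct)
    case (step j)
    then show ?case using eqmod_antimono[OF N_mono[OF step(1)] x_step] eqmod_trans by blast
  qed (simp add: xc)
  have "\<exists>v. \<forall>D. eqmod D v (x \<alpha> D)" for \<alpha>
    using eqmod_antimono[OF N_ge x_step] by (rule eqmod_limit_exists)
  then obtain T where T: "\<And>\<alpha> D. eqmod D (T \<alpha>) (x \<alpha> D)" by metis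
  have T_near: "eqmod (N \<alpha> i) (T \<alpha>) (x \<alpha> i)" for \<alpha> i
    using eqmod_trans[OF T x_far[OF N_ge]] .
  have neq: "g (T \<alpha>) \<noteq> g (T \<beta>)"
    if i: "i \<in> \<alpha>" "i \<notin> \<beta>" and agree: "\<And>j. j < i \<Longrightarrow> j \<in> \<alpha> \<longleftrightarrow> j \<in> \<beta>" for \<alpha> \<beta> i
  proof
    assume eq: "g (T \<alpha>) = g (T \<beta>)"
    have "node \<alpha> j = node \<beta> j" if "j \<le> i" for j
      using that by (induction j) (auto simp: node_0 node_Suc agree)
    then have same: "x \<alpha> i = x \<beta> i" "N \<alpha> i = N \<beta> i" by (auto simp: x_def N_def)
    let ?K = "K (x \<beta> i) (N \<beta> i)"
    have "eqmod ?K (g (T \<alpha>)) (g (x \<beta> i \<oplus> U (x \<beta> i) (N \<beta> i)))"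
      using cont[OF T_near[of \<alpha> "Suc i"]] i(1) by (simp add: x_Suc N_Suc same)
    moreover have "eqmod ?K (g (T \<beta>)) (g (x \<beta> i))"
      using cont[OF T_near[of \<beta> "Suc i"]] i(2) by (simp add: x_Suc N_Suc)
    ultimately have "eqmod ?K (g (x \<beta> i \<oplus> U (x \<beta> i) (N \<beta> i))) (g (x \<beta> i))"
      using eq eqmod_sym eqmod_trans by metis
    then show False using UK[OF xc] by blast
  qed
  have "inj (g \<circ> T)"
  proof (rule injI, rule ccontr)
    fix \<alpha> \<beta> assume eq: "(g \<circ> T) \<alpha> = (g \<circ> T) \<beta>" and "\<alpha> \<noteq> \<beta>"
    then have "\<exists>i. (i \<in> \<alpha>) \<noteq> (i \<in> \<beta>)" by blast
    then obtain i where "(i \<in> \<alpha>) \<noteq> (i \<in> \<beta>)" "\<And>j. j < i \<Longrightarrow> j \<in> \<alpha> \<longleftrightarrow> j \<in> \<beta>"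
      using exists_least_iff[of "\<lambda>i. (i \<in> \<alpha>) \<noteq> (i \<in> \<beta>)"] by blast
    then show False using neq[of i \<alpha> \<beta>] neq[of i \<beta> \<alpha>] eq by auto
  qed
  moreover have "range T \<subseteq> carrier R" using T eqmodD(1) by blast
  ultimately show ?thesis by blast
qed

text \<open>The Cantor scheme needs arbitrarily small nonzero displacements: the powers of a nonvanishing
  coefficient provide them, since a coefficient of positive degree lies in \<open>I\<close>.\<close>

lemma nonconstant_series_many_values:
  assumes c: "adic_coeffs c" and g: "\<And>s. s \<in> carrier R \<Longrightarrow> sums_to c s (g s)"
    and r: "r \<in> carrier R" "g r \<noteq> g \<zero>"
  shows "\<exists>T :: nat set \<Rightarrow> 'a. range T \<subseteq> carrier R \<and> inj (g \<circ> T)"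
proof (rule cantor_scheme)
  show "eqmod L (g x) (g y)" if "eqmod L x y" for L x y
    using sums_to_continuous[OF c g g that] eqmodD[OF that] by blast
  have "\<exists>k. c (Suc k) \<noteq> \<zero>"
    using sums_to_constant[OF c r(1) g[OF r(1)]] sums_to_at_zero[OF c g[OF zero_closed]] r(2)
    by metis
  then obtain k where k: "c (Suc k) \<noteq> \<zero>" by blast
  have "c (Suc k) \<in> I"
    using c Ipow_pos_subset[of "Suc k"] unfolding adic_coeffs_def by blast
  then have "c (Suc k) [^] n \<in> Ipow n" for n :: nat by (rule pow_in_Ipow)
  moreover have "c (Suc k) [^] n \<noteq> \<zero>" for n :: nat
    using k adic_coeffs_carrier[OF c] by (induction n) (auto simp: integral_iff)
  ultimately have small: "\<exists>u\<in>Ipow n. u \<noteq> \<zero>" for n by blast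
  fix x N assume x: "x \<in> carrier R"
  obtain N' where N': "\<forall>u\<in>Ipow N'. u \<noteq> \<zero> \<longrightarrow> g (x \<oplus> u) \<noteq> g x"
    using locally_avoids_value[OF c g r x] by blast
  \<comment> \<open>\<open>N\<close> keeps the displacement as small as required, \<open>N'\<close> makes the value change.\<close>
  obtain u where "u \<in> Ipow (max N N')" "u \<noteq> \<zero>" using small by blast
  then show "\<exists>u\<in>Ipow N. g (x \<oplus> u) \<noteq> g x"
    using N' Ipow_antimono[of N "max N N'"] Ipow_antimono[of N' "max N N'"] by auto
qed

end

section \<open>Power series in several variables\<close>

lemma finite_exponents: "finite {e \<in> tuples n UNIV. (\<Sum>i<n. e i) < (d::nat)}"
proof (rule finite_subset)
  show "finite ({..<n} \<rightarrow>\<^sub>E {..<d})" by (simp add: finite_PiE)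
  show "{e \<in> tuples n UNIV. (\<Sum>i<n. e i) < d} \<subseteq> {..<n} \<rightarrow>\<^sub>E {..<d}"
  proof
    fix e assume e: "e \<in> {e \<in> tuples n UNIV. (\<Sum>i<n. e i) < d}"
    have "e i < d" if "i < n" for i
      using e member_le_sum[of i "{..<n}" e] that by fastforce
    then show "e \<in> {..<n} \<rightarrow>\<^sub>E {..<d}" using e by (auto simp: tuples_def PiE_iff)
  qed
qed

lemma finite_exponents_eq: "finite {e \<in> tuples n UNIV. (\<Sum>i<n. e i) = (d::nat)}"
  by (rule finite_subset[OF _ finite_exponents[of n "Suc d"]]) auto

context complete_adic_domain
begin

lemma monomial_value_closed:
  "y \<in> tuples n (carrier R) \<Longrightarrow> monomial_value R n e y \<in> carrier R"
  unfolding monomial_value_def tuples_def by (intro finprod_closed) auto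

text \<open>This is why the homogeneous parts of a power series, evaluated at a tuple over \<open>I\<close>, form the
  coefficients of a series that converges on all of \<open>R\<close>.\<close>

lemma monomial_value_in_Ipow:
  assumes "y \<in> tuples n I"
  shows "monomial_value R n e y \<in> Ipow (\<Sum>i<n. e i)"
proof -
  have "(\<Otimes>i\<in>S. y i [^] e i) \<in> Ipow (\<Sum>i\<in>S. e i)"
    if "finite S" "\<And>i. i \<in> S \<Longrightarrow> y i \<in> I" for S
    using that
  proof (induction S)
    case (insert j S)
    have "(\<Otimes>i\<in>insert j S. y i [^] e i) = y j [^] e j \<otimes> (\<Otimes>i\<in>S. y i [^] e i)"
      using insert ideal.Icarr[OF ideal_I] by (intro finprod_insert) auto
    then show ?case using insert pow_in_Ipow Ipow_mult by simp
  qed (simp add: Ipow_0)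
  then show ?thesis using assms by (auto simp: monomial_value_def tuples_def)
qed

definition scale_tuple :: "nat \<Rightarrow> 'a \<Rightarrow> (nat \<Rightarrow> 'a) \<Rightarrow> nat \<Rightarrow> 'a" where
  "scale_tuple n s y = (\<lambda>i\<in>{..<n}. s \<otimes> y i)"

lemma scale_tuple_in_tuples:
  "s \<in> carrier R \<Longrightarrow> y \<in> tuples n (Ipow L) \<Longrightarrow> scale_tuple n s y \<in> tuples n (Ipow L)"
  by (auto simp: scale_tuple_def tuples_def intro: Ipow_lmult)

lemma monomial_value_scale:
  assumes y: "y \<in> tuples n (carrier R)" and s: "s \<in> carrier R"
  shows "monomial_value R n e (scale_tuple n s y) = s [^] (\<Sum>i<n. e i) \<otimes> monomial_value R n e y"
proof -
  have "(\<Otimes>i\<in>S. (s \<otimes> y i) [^] e i) = s [^] (\<Sum>i\<in>S. e i) \<otimes> (\<Otimes>i\<in>S. y i [^] e i)"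
    if "finite S" "\<And>i. i \<in> S \<Longrightarrow> y i \<in> carrier R" for S
    using that
  proof (induction S)
    case (insert j S)
    let ?P = "\<Otimes>i\<in>S. y i [^] e i"
    have P: "?P \<in> carrier R" using insert by (intro finprod_closed) auto
    have "(\<Otimes>i\<in>insert j S. (s \<otimes> y i) [^] e i) = (s \<otimes> y j) [^] e j \<otimes> (\<Otimes>i\<in>S. (s \<otimes> y i) [^] e i)"
      using insert s by (intro finprod_insert) auto
    moreover have "(\<Otimes>i\<in>insert j S. y i [^] e i) = y j [^] e j \<otimes> ?P"
      using insert by (intro finprod_insert) auto
    ultimately show ?case
      using insert s P by (simp add: nat_pow_distrib nat_pow_mult[symmetric] m_ac)
  qed simp
  then have "(\<Otimes>i\<in>{..<n}. (s \<otimes> y i) [^] e i) = s [^] (\<Sum>i<n. e i) \<otimes> monomial_value R n e y"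
    using y by (auto simp: monomial_value_def tuples_def)
  moreover have "(\<Otimes>i\<in>{..<n}. scale_tuple n s y i [^] e i) = (\<Otimes>i\<in>{..<n}. (s \<otimes> y i) [^] e i)"
    using y s by (intro finprod_cong') (auto simp: scale_tuple_def tuples_def)
  ultimately show ?thesis by (simp add: monomial_value_def)
qed

definition homogeneous_part :: "nat \<Rightarrow> ((nat \<Rightarrow> nat) \<Rightarrow> 'a) \<Rightarrow> (nat \<Rightarrow> 'a) \<Rightarrow> nat \<Rightarrow> 'a" where
  "homogeneous_part n F y k =
     (\<Oplus>e\<in>{e \<in> tuples n UNIV. (\<Sum>i<n. e i) = k}. F e \<otimes> monomial_value R n e y)"

lemma finsum_in_Ipow:
  assumes "finite S" "\<And>e. e \<in> S \<Longrightarrow> f e \<in> Ipow k"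
  shows "(\<Oplus>e\<in>S. f e) \<in> Ipow k"
  using assms
proof (induction S)
  case (insert e S)
  then show ?case by (subst finsum_insert) (auto intro: Ipow_add Ipow_carrier[of _ k])
qed simp

lemma adic_coeffs_homogeneous_part:
  assumes F: "F \<in> power_series R n" and y: "y \<in> tuples n I"
  shows "adic_coeffs (homogeneous_part n F y)"
  unfolding adic_coeffs_def homogeneous_part_def
  using F monomial_value_in_Ipow[OF y]
  by (auto simp: power_series_def intro!: finsum_in_Ipow finite_exponents_eq Ipow_lmult)

text \<open>Truncating by total degree matches truncating by the degree in \<open>s\<close>, so the value of the power series
  at \<open>s y\<close> is the sum of a one-variable series term by term.\<close>

lemma truncation_scale:
  assumes F: "F \<in> power_series R n" and y: "y \<in> tuples n I" and s: "s \<in> carrier R"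
  shows "(\<Oplus>e\<in>{e \<in> tuples n UNIV. (\<Sum>i<n. e i) < d}. F e \<otimes> monomial_value R n e (scale_tuple n s y))
    = partial_sum (homogeneous_part n F y) s d"
proof (induction d)
  case (Suc d)
  let ?f = "\<lambda>e. F e \<otimes> monomial_value R n e (scale_tuple n s y)"
  let ?E = "{e \<in> tuples n UNIV. (\<Sum>i<n. e i) = d}"
  have yc: "y \<in> tuples n (carrier R)" using y ideal.Icarr[OF ideal_I] by (auto simp: tuples_def)
  then have "scale_tuple n s y \<in> tuples n (carrier R)"
    using s by (auto simp: scale_tuple_def tuples_def)
  then have f: "?f e \<in> carrier R" if "e \<in> tuples n UNIV" for e
    using that F monomial_value_closed by (auto simp: power_series_def)
  have g: "F e \<otimes> monomial_value R n e y \<in> carrier R" if "e \<in> tuples n UNIV" for e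
    using that F monomial_value_closed[OF yc] by (auto simp: power_series_def)
  have Fc: "F e \<in> carrier R" if "e \<in> tuples n UNIV" for e
    using that F by (auto simp: power_series_def)
  have "{e \<in> tuples n UNIV. (\<Sum>i<n. e i) < Suc d} = {e \<in> tuples n UNIV. (\<Sum>i<n. e i) < d} \<union> ?E"
    by auto
  then have "(\<Oplus>e\<in>{e \<in> tuples n UNIV. (\<Sum>i<n. e i) < Suc d}. ?f e) =
      (\<Oplus>e\<in>{e \<in> tuples n UNIV. (\<Sum>i<n. e i) < d}. ?f e) \<oplus> (\<Oplus>e\<in>?E. ?f e)"
    using f by (auto intro!: finsum_Un_disjoint finite_exponents finite_exponents_eq)
  also have "(\<Oplus>e\<in>?E. ?f e) = (\<Oplus>e\<in>?E. (F e \<otimes> monomial_value R n e y) \<otimes> s [^] d)"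
    using Fc s g monomial_value_closed[OF yc]
    by (intro finsum_cong') (auto simp: monomial_value_scale[OF yc s] m_ac)
  also have "\<dots> = homogeneous_part n F y d \<otimes> s [^] d"
    using g s unfolding homogeneous_part_def
    by (intro finsum_ldistr[symmetric] finite_exponents_eq) auto
  finally show ?case
    using Suc s adic_coeffs_carrier[OF adic_coeffs_homogeneous_part[OF F y]] by (simp add: partial_sum_Suc)
qed simp

text \<open>The values along the line through zero and \<open>y\<close> suffice: at \<open>s = 0\<close> and \<open>s = 1\<close> they differ by
  assumption, so the one-variable case applies.\<close>

lemma nonconstant_germ_many_values:
  assumes F: "F \<in> power_series R n" and L: "L > 0" and y: "y \<in> tuples n (Ipow L)"
    and h: "\<And>z. z \<in> tuples n (Ipow L) \<Longrightarrow> limitin (adic_topology R I)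
       (\<lambda>d. \<Oplus>e\<in>{e \<in> tuples n UNIV. (\<Sum>i<n. e i) < d}. F e \<otimes> monomial_value R n e z)
       (h z) sequentially"
    and neq: "h y \<noteq> h (\<lambda>i\<in>{..<n}. \<zero>)"
  shows "\<exists>T :: nat set \<Rightarrow> nat \<Rightarrow> 'a. range T \<subseteq> tuples n (Ipow L) \<and> inj (h \<circ> T)"
proof -
  have yI: "y \<in> tuples n I" using y Ipow_pos_subset[OF L] by (auto simp: tuples_def)
  define g where "g s = h (scale_tuple n s y)" for s
  have c: "adic_coeffs (homogeneous_part n F y)" using F yI by (rule adic_coeffs_homogeneous_part)
  have sums: "sums_to (homogeneous_part n F y) s (g s)" if s: "s \<in> carrier R" for s
  proof -
    have lim: "limitin (adic_topology R I) (partial_sum (homogeneous_part n F y) s) (g s) sequentially"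
      using h[OF scale_tuple_in_tuples[OF s y]] unfolding g_def truncation_scale[OF F yI s] .
    show ?thesis
      unfolding sums_to_def by (intro allI limitin_eqmod[OF _ lim] partial_sum_step[OF c s])
  qed
  have yi: "y i \<in> carrier R" if "i < n" for i
    using PiE_mem[of y "{..<n}" "\<lambda>_. Ipow L" i] y that by (simp add: tuples_def)
  have "scale_tuple n \<one> y = y"
    using y yi by (intro ext) (auto simp: scale_tuple_def tuples_def PiE_iff extensional_def)
  moreover have "scale_tuple n \<zero> y = (\<lambda>i\<in>{..<n}. \<zero>)"
    using yi by (intro ext) (auto simp: scale_tuple_def)
  ultimately have "g \<one> \<noteq> g \<zero>" using neq by (simp add: g_def)
  then obtain T :: "nat set \<Rightarrow> 'a" where T: "range T \<subseteq> carrier R" "inj (g \<circ> T)"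
    using nonconstant_series_many_values[OF c sums one_closed] by blast
  let ?T = "\<lambda>\<alpha>. scale_tuple n (T \<alpha>) y"
  have "h \<circ> ?T = g \<circ> T" by (auto simp: g_def)
  moreover have "range ?T \<subseteq> tuples n (Ipow L)" using T(1) scale_tuple_in_tuples y by blast
  ultimately show ?thesis using T(2) by metis
qed

lemma tuple_add_image_eq:
  assumes x: "x \<in> tuples n (carrier R)"
  shows "tuple_add R n x ` tuples n (Ipow L) = (\<Pi>\<^sub>E i\<in>{..<n}. x i <+ Ipow L)"
proof
  show "tuple_add R n x ` tuples n (Ipow L) \<subseteq> (\<Pi>\<^sub>E i\<in>{..<n}. x i <+ Ipow L)"
    by (auto simp: tuple_add_def tuples_def a_l_coset_defs)
  show "(\<Pi>\<^sub>E i\<in>{..<n}. x i <+ Ipow L) \<subseteq> tuple_add R n x ` tuples n (Ipow L)"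
  proof
    fix z assume z: "z \<in> (\<Pi>\<^sub>E i\<in>{..<n}. x i <+ Ipow L)"
    then have "\<forall>i\<in>{..<n}. \<exists>u\<in>Ipow L. z i = x i \<oplus> u" by (fastforce simp: a_l_coset_defs)
    then obtain u where u: "\<And>i. i < n \<Longrightarrow> u i \<in> Ipow L \<and> z i = x i \<oplus> u i" by (metis lessThan_iff)
    then have "z = tuple_add R n x (\<lambda>i\<in>{..<n}. u i)"
      using z by (intro ext) (auto simp: tuple_add_def PiE_iff extensional_def)
    moreover have "(\<lambda>i\<in>{..<n}. u i) \<in> tuples n (Ipow L)" using u by (auto simp: tuples_def)
    ultimately show "z \<in> tuple_add R n x ` tuples n (Ipow L)" by blast
  qed
qed

lemma openin_tuple_add_image:
  assumes x: "x \<in> tuples n (carrier R)"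
  shows "openin (product_topology (\<lambda>_. adic_topology R I) {..<n})
    (tuple_add R n x ` tuples n (Ipow L))"
  unfolding tuple_add_image_eq[OF x] using x openin_coset
  by (subst openin_PiE) (auto simp: tuples_def)

lemma tuple_add_zero:
  assumes x: "x \<in> tuples n (carrier R)"
  shows "tuple_add R n x (\<lambda>i\<in>{..<n}. \<zero>) = x"
  using x by (intro ext) (auto simp: tuple_add_def tuples_def PiE_iff extensional_def)

end

section \<open>Analytic maps with small image\<close>

lemma (in pro_p_domain) complete_adic_domain_max_ideal: "complete_adic_domain R (max_ideal R)"
proof -
  have "maximalideal (max_ideal R) R" unfolding max_ideal_def using local by (rule theI')
  then have "ideal (max_ideal R) R" by (rule maximalideal.axioms(1))
  then show ?thesis
    using domain_axioms complete
    by (intro complete_adic_domain.intro complete_adic_domain_axioms.intro)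
qed

text \<open>If the map were not constant on the ball around \<open>x\<close> on which its expansion is valid, then one of its
  coordinates would not be either, and that coordinate alone would already have continuum many
  values.\<close>

lemma analytic_map_locally_constant:
  fixes R :: "('a, 'b) ring_scheme"
  assumes R: "complete_adic_domain R (max_ideal R)" and f: "analytic_map R m n U f"
    and small: "\<not> (UNIV :: nat set set) \<lesssim> f ` U" and x: "x \<in> U"
  shows "\<exists>W. openin (tuple_topology R m) W \<and> x \<in> W \<and> W \<subseteq> U \<and> (\<forall>z\<in>W. f z = f x)"
proof -
  interpret complete_adic_domain R "max_ideal R" by (rule R)
  have "U \<subseteq> topspace (tuple_topology R m)"
    using f openin_subset unfolding analytic_map_def by blast
  then have xc: "x \<in> tuples m (carrier R)"
    using x by (auto simp: tuple_topology_def topspace_adic tuples_def)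
  obtain L F where L: "L > 0" and sub: "tuple_add R m x ` tuples m (Ipow L) \<subseteq> U"
    and F: "F \<in> tuples n (power_series R m)"
    and val: "\<And>y j. y \<in> tuples m (Ipow L) \<Longrightarrow> j < n \<Longrightarrow>
      power_series_has_value R m (F j) y (f (tuple_add R m x y) j)"
    using f x unfolding analytic_map_def Ipow_def by meson
  have fU: "f z \<in> tuples n (carrier R)" if "z \<in> U" for z
    using f that unfolding analytic_map_def by blast
  let ?W = "tuple_add R m x ` tuples m (Ipow L)"
  have z0: "(\<lambda>i\<in>{..<m}. \<zero>\<^bsub>R\<^esub>) \<in> tuples m (Ipow L)" by (auto simp: tuples_def)
  have const: "f (tuple_add R m x y) = f x" if y: "y \<in> tuples m (Ipow L)" for y
  proof (rule ccontr)
    assume "f (tuple_add R m x y) \<noteq> f x"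
    moreover have "f (tuple_add R m x y) \<in> {..<n} \<rightarrow>\<^sub>E carrier R" "f x \<in> {..<n} \<rightarrow>\<^sub>E carrier R"
      using fU sub y x by (auto simp: tuples_def)
    ultimately obtain j where j: "j < n" "f (tuple_add R m x y) j \<noteq> f x j"
      using PiE_ext by (metis lessThan_iff)
    define h where "h y = f (tuple_add R m x y) j" for y
    obtain T :: "nat set \<Rightarrow> nat \<Rightarrow> 'a" where T: "range T \<subseteq> tuples m (Ipow L)" "inj (h \<circ> T)"
    proof (rule exE[OF nonconstant_germ_many_values[of "F j" m L y h]])
      show "F j \<in> power_series R m" using F j(1) by (auto simp: tuples_def)
      show "h y \<noteq> h (\<lambda>i\<in>{..<m}. \<zero>\<^bsub>R\<^esub>)" using j(2) xc by (simp add: h_def tuple_add_zero)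
    qed (use L y val[OF _ j(1)] in \<open>auto simp: h_def power_series_has_value_def\<close>)
    let ?S = "\<lambda>\<alpha>. f (tuple_add R m x (T \<alpha>))"
    have "inj ?S" using T(2) by (auto simp: inj_def h_def)
    moreover have "range ?S \<subseteq> f ` U" using T(1) sub by blast
    ultimately show False using small by (auto simp: lepoll_def)
  qed
  have "openin (tuple_topology R m) ?W"
    unfolding tuple_topology_def using xc by (rule openin_tuple_add_image)
  moreover have "x \<in> ?W" using tuple_add_zero[OF xc] z0 by (metis imageI)
  ultimately show ?thesis using sub const by blast
qed

text \<open>Read in charts, \<open>F\<close> becomes an analytic map whose image comes from a part of the image of \<open>F\<close> by
  applying the chart of \<open>N\<close>, so it is small as well. Its local constancy at \<open>\<phi> x\<close> is carried back to \<open>M\<close> by the injectivity of both charts.\<close>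

lemma manifold_analytic_map_locally_constant:
  fixes R :: "('a, 'b) ring_scheme" and F :: "'m \<Rightarrow> 'n"
  assumes R: "complete_adic_domain R (max_ideal R)"
    and M: "analytic_manifold R M A" and N: "analytic_manifold R N B"
    and F: "manifold_analytic_map R M A N B F"
    and small: "\<not> (UNIV :: nat set set) \<lesssim> F ` topspace M" and x: "x \<in> topspace M"
  shows "\<exists>W. openin M W \<and> x \<in> W \<and> (\<forall>z\<in>W. F z = F x)"
proof -
  obtain U \<phi> m V \<psi> n where c: "(U, \<phi>, m) \<in> A" "(V, \<psi>, n) \<in> B" and xU: "x \<in> U" and FxV: "F x \<in> V"
    and f: "analytic_map R m n (\<phi> ` (U \<inter> {z \<in> topspace M. F z \<in> V})) (\<psi> \<circ> F \<circ> inv_into U \<phi>)"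
    using F x unfolding manifold_analytic_map_def by blast
  have "is_chart R M (U, \<phi>, m)" "is_chart R N (V, \<psi>, n)"
    using M N c unfolding analytic_manifold_def by blast+
  then have U: "openin M U" and \<phi>: "openin (tuple_topology R m) (\<phi> ` U)"
      "homeomorphic_map (subtopology M U) (subtopology (tuple_topology R m) (\<phi> ` U)) \<phi>"
    and V: "openin N V"
    and \<psi>: "homeomorphic_map (subtopology N V) (subtopology (tuple_topology R n) (\<psi> ` V)) \<psi>"
    by (auto simp: is_chart_def)
  have UM: "U \<subseteq> topspace M" "V \<subseteq> topspace N" using U V openin_subset by blast+
  have inj: "inj_on \<phi> U" "inj_on \<psi> V"
    using homeomorphic_imp_injective_map[OF \<phi>(2)] homeomorphic_imp_injective_map[OF \<psi>] UM
    by (simp_all add: topspace_subtopology Int_absorb1)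
  let ?P = "U \<inter> {z \<in> topspace M. F z \<in> V}"
  let ?f = "\<psi> \<circ> F \<circ> inv_into U \<phi>"
  have fz: "?f (\<phi> z) = \<psi> (F z)" if "z \<in> U" for z using that inj(1) by simp
  have "?f ` \<phi> ` ?P \<subseteq> \<psi> ` F ` topspace M" using fz by fastforce
  then have "?f ` \<phi> ` ?P \<lesssim> F ` topspace M"
    by (rule lepoll_trans[OF subset_imp_lepoll image_lepoll])
  then have small': "\<not> (UNIV :: nat set set) \<lesssim> ?f ` \<phi> ` ?P" using small lepoll_trans by blast
  obtain W where W: "openin (tuple_topology R m) W" "\<phi> x \<in> W" "W \<subseteq> \<phi> ` ?P"
    "\<forall>z\<in>W. ?f z = ?f (\<phi> x)"
    using analytic_map_locally_constant[OF R f small', of "\<phi> x"] x xU FxV by blast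
  let ?W = "{z \<in> topspace (subtopology M U). \<phi> z \<in> W}"
  have "openin (subtopology (tuple_topology R m) (\<phi> ` U)) W"
    using W(1,3) \<phi>(1) by (auto simp: openin_open_subtopology)
  then have "openin (subtopology M U) ?W"
    using homeomorphic_imp_continuous_map[OF \<phi>(2)] by (rule openin_continuous_map_preimage[rotated])
  then have "openin M ?W" using U by (auto simp: openin_open_subtopology)
  moreover have "x \<in> ?W" using x xU W(2) by (simp add: topspace_subtopology)
  moreover have "F z = F x" if "z \<in> ?W" for z
  proof -
    have zU: "z \<in> U" and zW: "\<phi> z \<in> W" using that by (auto simp: topspace_subtopology)
    then obtain z' where z': "z' \<in> ?P" "\<phi> z = \<phi> z'" using W(3) by blast
    then have "z = z'" using inj(1) zU by (auto dest: inj_onD)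
    then have "F z \<in> V" using z' by blast
    moreover have "\<psi> (F z) = \<psi> (F x)" using W(4) zW fz[OF zU] fz[OF xU] by metis
    ultimately show ?thesis using inj(2) FxV by (auto dest: inj_onD)
  qed
  ultimately show ?thesis by blast
qed

lemma compact_space_locally_constant_finite_image:
  assumes comp: "compact_space M"
    and loc: "\<And>x. x \<in> topspace M \<Longrightarrow> \<exists>W. openin M W \<and> x \<in> W \<and> (\<forall>z\<in>W. F z = F x)"
  shows "finite (F ` topspace M)"
proof -
  obtain W where W: "\<And>x. x \<in> topspace M \<Longrightarrow> openin M (W x) \<and> x \<in> W x \<and> (\<forall>z\<in>W x. F z = F x)"
    using loc by metis
  have "topspace M \<subseteq> \<Union>(W ` topspace M)" using W by blast
  moreover have "\<And>U. U \<in> W ` topspace M \<Longrightarrow> openin M U" using W by blast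
  ultimately obtain \<F> where \<F>: "finite \<F>" "\<F> \<subseteq> W ` topspace M" "topspace M \<subseteq> \<Union>\<F>"
    using comp unfolding compact_space_alt by meson
  then obtain X where X: "finite X" "X \<subseteq> topspace M" "\<F> = W ` X"
    using finite_subset_image by metis
  have "F ` topspace M \<subseteq> F ` X"
  proof
    fix v assume "v \<in> F ` topspace M"
    then obtain z where z: "z \<in> topspace M" "v = F z" by blast
    then obtain x where "x \<in> X" "z \<in> W x" using \<F>(3) X(3) by blast
    then show "v \<in> F ` X" using W X(2) z(2) by blast
  qed
  then show ?thesis using X(1) finite_subset by blast
qed

theorem proposition2p7:
  fixes p :: nat
    and R :: "('a, 'b) ring_scheme"
    and M :: "'m topology" and A :: "('a, 'm) chart set"
    and N :: "'n topology" and B :: "('a, 'n) chart set"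
    and F :: "'m \<Rightarrow> 'n"
  assumes "pro_p_domain p R"
    and "analytic_manifold R M A" and "compact_space M"
    and "analytic_manifold R N B" and "compact_space N"
    and "manifold_analytic_map R M A N B F"
    and "F ` topspace M \<prec> (UNIV :: nat set set)"
  shows "finite (F ` topspace M)"
proof (rule compact_space_locally_constant_finite_image[OF assms(3)])
  have "\<not> (UNIV :: nat set set) \<lesssim> F ` topspace M"
    using assms(7) lepoll_antisym unfolding lesspoll_def by blast
  then show "\<exists>W. openin M W \<and> x \<in> W \<and> (\<forall>z\<in>W. F z = F x)" if "x \<in> topspace M" for x
    using manifold_analytic_map_locally_constant
      [OF pro_p_domain.complete_adic_domain_max_ideal[OF assms(1)] assms(2,4,6)] that by blast
qed

end
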